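(* Let $\{r_n\}_{n=1}^\infty$ be a sequence of reals with $r_n > \frac{1}{2}$ for every $n$. For $n \in \mathbb{N}$ set $$p(n) = \frac{m(n)}{8r_n^2} + f\!\left(\frac{m(n)}{8r_n^2}\right),$$ i.e. $p(n)$ is the smallest prime strictly greater than $\frac{m(n)}{8r_n^2}$. Then for every $n \in \mathbb{N}$ such that $$\frac{m(n)}{4} < p(n) \le \frac{m(n)}{2},$$ we have $$\chi(S_{r_n}^{n-1}) \ge \frac{\binom{m(n)}{m(n)/2}}{\binom{m(n)}{p(n)}}.$$
   Context: $S_r^{n-1} = \{x \in \mathbb{R}^n : \|x\|_2 = r\}$ is the Euclidean sphere of radius $r$ in $\mathbb{R}^n$; $\chi(S_r^{n-1})$ is the minimum number of colours needed to colour its points so that any two points at Euclidean distance exactly $1$ receive different colours. For real $x \ge 0$, $f(x)$ is defined by $x + f(x) = \min\{p \text{ prime} : p > x\}$. For real $x$, $m(x) = \max\{m < x : m \equiv 0 \pmod 4\}$ (the largest nonnegative integer multiple of $4$ strictly less than $x$). $\binom{a}{b}$ denotes the binomial coefficient. *)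

theory Defs
  imports "HOL-Analysis.Analysis" "HOL-Computational_Algebra.Primes"
begin

definition unit_distance_colouring :: "'a::metric_space set \<Rightarrow> nat \<Rightarrow> ('a \<Rightarrow> nat) \<Rightarrow> bool" where
  "unit_distance_colouring S k c \<longleftrightarrow>
     c ` S \<subseteq> {..<k} \<and> (\<forall>x\<in>S. \<forall>y\<in>S. dist x y = 1 \<longrightarrow> c x \<noteq> c y)"

text \<open>
  The minimum below is only meaningful if some finite colouring exists; this is always the case
  for compact sets, in particular for spheres (see \<open>compact_unit_distance_colouring\<close>).
\<close>

definition chromatic_number :: "'a::metric_space set \<Rightarrow> nat" where
  "chromatic_number S = (LEAST k. \<exists>c. unit_distance_colouring S k c)"

lemma compact_unit_distance_colouring:
  assumes "compact S"
  shows "\<exists>k c. unit_distance_colouring S k c"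
proof -
  have "\<exists>F. finite F \<and> S \<subseteq> (\<Union>z\<in>F. ball z (1/2))"
    using assms unfolding compact_eq_totally_bounded by (meson half_gt_zero zero_less_one)
  then obtain F where F: "finite F" "S \<subseteq> (\<Union>z\<in>F. ball z (1/2))"
    by blast
  obtain h where h: "bij_betw h F {..<card F}"
    using F(1) finite_same_card_bij[of F "{..<card F}"] by auto
  have "\<exists>z. z \<in> F \<and> dist z x < 1/2" if "x \<in> S" for x
    using F(2) that by (auto simp: subset_iff)
  then obtain g where g: "\<And>x. x \<in> S \<Longrightarrow> g x \<in> F" "\<And>x. x \<in> S \<Longrightarrow> dist (g x) x < 1/2"
    by metis
  have "h (g x) < card F" if "x \<in> S" for x
    using bij_betwE[OF h] g(1)[OF that] by auto
  moreover have "h (g x) \<noteq> h (g y)" if "x \<in> S" "y \<in> S" "dist x y = 1" for x y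
  proof
    assume "h (g x) = h (g y)"
    then have "g x = g y"
      using bij_betw_imp_inj_on[OF h] g(1) that by (auto dest: inj_onD)
    then show False
      using g(2)[OF that(1)] g(2)[OF that(2)] that(3) dist_triangle3[of x y "g x"] by simp
  qed
  ultimately have "unit_distance_colouring S (card F) (\<lambda>x. h (g x))"
    unfolding unit_distance_colouring_def by auto
  then show ?thesis by blast
qed

text \<open>The distance from \<open>x\<close> to the next prime; meant for \<open>x \<ge> 0\<close>.\<close>

definition prime_gap :: "real \<Rightarrow> real" where
  "prime_gap x = real (LEAST p. prime p \<and> real p > x) - x"

text \<open>
  Multiples of 4 are taken in the natural numbers; the set is finite, and it is nonempty
  exactly for \<open>x > 0\<close>.
\<close>

definition max_mult4 :: "real \<Rightarrow> nat" where
  "max_mult4 x = Max {m. real m < x \<and> 4 dvd m}"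

end

theory Submission
  imports Defs
begin

text \<open>
  Put the vectors with entries \<open>\<plusminus>s\<close>, \<open>s\<^sup>2 = 1/(8p)\<close>, and equally many of both signs into the first
  \<open>m\<close> coordinates. Their squared norm \<open>m/(8p)\<close> is less than \<open>r\<^sup>2\<close>, so one of the remaining
  coordinates can be used to lift them to the sphere. Two of them are at distance 1 iff the
  corresponding \<open>m/2\<close>-sets \<open>A\<close>, \<open>B\<close> satisfy \<open>|A \<inter> B| = m/2 - p\<close>. Since \<open>2p > m/2\<close>, a colour class
  is therefore a family of \<open>m/2\<close>-sets with \<open>|A \<inter> B|\<close> not congruent to \<open>m/2\<close> modulo \<open>p\<close> for
  \<open>A \<noteq> B\<close>, and the Frankl-Wilson theorem bounds it by \<open>m choose (p - 1)\<close>.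
\<close>

section \<open>Integer linear algebra\<close>

text \<open>Gaussian elimination by cross-multiplication, which stays inside the integers: each
  nonzero equation removes one unknown, so with more unknowns than equations one is left to be
  chosen freely.\<close>

lemma homogeneous_int_system_nontrivial:
  fixes M :: "'e \<Rightarrow> 'v \<Rightarrow> int"
  assumes "finite E" "finite V" "card E < card V"
  shows "\<exists>c. (\<exists>v\<in>V. c v \<noteq> 0) \<and> (\<forall>e\<in>E. (\<Sum>v\<in>V. c v * M e v) = 0)"
  using assms
proof (induction E arbitrary: V M rule: finite_induct)
  case empty
  then have "V \<noteq> {}" by auto
  then show ?case by (intro exI[of _ "\<lambda>_. 1"]) auto
next
  case (insert e E)
  show ?case
  proof (cases "\<forall>v\<in>V. M e v = 0")
    case True
    with insert.IH[of V M] insert.prems insert.hyps show ?thesis by force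
  next
    case False
    then obtain w where w: "w \<in> V" "M e w \<noteq> 0" by blast
    let ?W = "V - {w}"
    have "card E < card ?W"
      using insert.prems insert.hyps w by simp
    from insert.IH[OF _ this, of "\<lambda>f v. M e w * M f v - M f w * M e v"] insert.prems
    obtain c v where v: "v \<in> ?W" "c v \<noteq> 0"
      and c: "\<And>f. f \<in> E \<Longrightarrow> (\<Sum>v\<in>?W. c v * (M e w * M f v - M f w * M e v)) = 0"
      by auto
    \<comment> \<open>The value at \<open>w\<close> is forced by equation \<open>e\<close>; scaling
      all other values by \<open>M e w\<close> avoids the division.\<close>
    define d where "d u = (if u = w then - (\<Sum>v\<in>?W. c v * M e v) else M e w * c u)" for u
    have split: "(\<Sum>v\<in>V. d v * M f v) = (\<Sum>v\<in>?W. c v * (M e w * M f v - M f w * M e v))" for f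
    proof -
      have "(\<Sum>v\<in>V. d v * M f v) = d w * M f w + (\<Sum>v\<in>?W. d v * M f v)"
        using insert.prems w by (simp add: sum.remove)
      also have "(\<Sum>v\<in>?W. d v * M f v) = (\<Sum>v\<in>?W. M e w * c v * M f v)"
        by (intro sum.cong) (auto simp: d_def)
      finally show ?thesis
        by (simp add: d_def algebra_simps sum_subtractf sum_distrib_left)
    qed
    have "d v \<noteq> 0" using v w by (auto simp: d_def)
    moreover have "(\<Sum>v\<in>V. d v * M f v) = 0" if "f \<in> insert e E" for f
      using that c split by auto
    ultimately show ?thesis using v by blast
  qed
qed

section \<open>Moments of integer weights on a set family\<close>

text \<open>Regard \<open>of_bool (I \<subseteq> B)\<close> as a monomial in the indicator of
  \<open>B\<close>. Multiplying it by \<open>card (A \<inter> B)\<close> yields monomials of degree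
  at most one higher.\<close>

lemma sum_of_bool_insert_subset:
  assumes "finite A"
  shows "(\<Sum>j\<in>A. of_bool (insert j I \<subseteq> B)) = of_bool (I \<subseteq> B) * int (card (A \<inter> B))"
proof -
  have "(\<Sum>j\<in>A. of_bool (insert j I \<subseteq> B)) = (\<Sum>j\<in>A. if j \<in> B then of_bool (I \<subseteq> B) else (0::int))"
    by (intro sum.cong) auto
  also have "\<dots> = (\<Sum>j\<in>A \<inter> B. of_bool (I \<subseteq> B))"
    by (rule sum.inter_restrict[symmetric]) (rule assms)
  finally show ?thesis by simp
qed

text \<open>
  On the slice of \<open>k\<close>-sets, \<open>(k - |I|) x\<^sub>I = \<Sum>\<^sub>j x\<^sub>I\<^sub>\<union>\<^sub>{\<^sub>j\<^sub>}\<close> with \<open>j\<close> ranging over the complement of \<open>I\<close>.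
  The factor may vanish modulo \<open>p\<close>; this is why the coefficients are integers.
\<close>

lemma lower_degree_moments_vanish:
  fixes c :: "'a set \<Rightarrow> int"
  assumes "finite U" and F: "\<And>B. B \<in> F \<Longrightarrow> B \<subseteq> U \<and> card B = k" and "s \<le> k"
    and top: "\<And>J. J \<subseteq> U \<Longrightarrow> card J = s \<Longrightarrow> (\<Sum>B\<in>F. c B * of_bool (J \<subseteq> B)) = 0"
    and "I \<subseteq> U" "card I \<le> s"
  shows "(\<Sum>B\<in>F. c B * of_bool (I \<subseteq> B)) = 0"
  using \<open>card I \<le> s\<close> \<open>I \<subseteq> U\<close>
proof (induction "s - card I" arbitrary: I)
  case 0
  then show ?case using top by simp
next
  case (Suc d)
  have fin: "finite I" using Suc.prems \<open>finite U\<close> finite_subset by blast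
  have step: "(\<Sum>j\<in>U - I. of_bool (insert j I \<subseteq> B)) = (int k - int (card I)) * of_bool (I \<subseteq> B)"
    if "B \<in> F" for B
  proof (cases "I \<subseteq> B")
    case True
    have "(U - I) \<inter> B = B - I" using F that by blast
    moreover have "card (B - I) = k - card I" "card I \<le> k"
      using True F[OF that] fin \<open>finite U\<close> card_mono[of B I]
      by (auto simp: card_Diff_subset finite_subset)
    ultimately show ?thesis
      using True \<open>finite U\<close> by (simp add: sum_of_bool_insert_subset of_nat_diff)
  qed auto
  have "(int k - int (card I)) * (\<Sum>B\<in>F. c B * of_bool (I \<subseteq> B))
      = (\<Sum>B\<in>F. c B * (\<Sum>j\<in>U - I. of_bool (insert j I \<subseteq> B)))"
    unfolding sum_distrib_left[of "int k - int (card I)"]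
    by (intro sum.cong refl) (simp add: step mult_ac del: insert_subset)
  also have "\<dots> = (\<Sum>j\<in>U - I. \<Sum>B\<in>F. c B * of_bool (insert j I \<subseteq> B))"
    unfolding sum_distrib_left by (rule sum.swap)
  also have "\<dots> = 0"
  proof (rule sum.neutral, rule ballI)
    fix j assume "j \<in> U - I"
    then show "(\<Sum>B\<in>F. c B * of_bool (insert j I \<subseteq> B)) = 0"
      using Suc.prems Suc.hyps(2) fin by (intro Suc.hyps(1)) auto
  qed
  \<comment> \<open>Here \<open>card I < s \<le> k\<close>, so the factor is a nonzero integer and
    cancels.\<close>
  finally show ?case using Suc.hyps(2) \<open>s \<le> k\<close> by auto
qed

text \<open>Expanding the product gives monomials of degree at most
  \<open>card I + d \<le> s\<close>, whose moments vanish. The free \<open>I\<close> carries the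
  induction: a factor \<open>card (A \<inter> B)\<close> replaces \<open>I\<close> by the sets
  \<open>insert j I\<close>.\<close>

lemma intersection_polynomial_moments_vanish:
  fixes c :: "'a set \<Rightarrow> int"
  assumes "finite A"
    and mom: "\<And>I. finite I \<Longrightarrow> I \<subseteq> U \<Longrightarrow> card I \<le> s \<Longrightarrow> (\<Sum>B\<in>F. c B * of_bool (I \<subseteq> B)) = 0"
    and "A \<subseteq> U" "finite I" "I \<subseteq> U" "card I + d \<le> s"
  shows "(\<Sum>B\<in>F. c B * of_bool (I \<subseteq> B) * (\<Prod>i=1..d. int (card (A \<inter> B)) - a - int i)) = 0"
  using assms(4-)
proof (induction d arbitrary: I)
  case 0
  then show ?case using mom by simp
next
  case (Suc d)
  let ?q = "\<lambda>B. \<Prod>i=1..d. int (card (A \<inter> B)) - a - int i"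
  have "(\<Sum>B\<in>F. c B * of_bool (I \<subseteq> B) * (\<Prod>i=1..Suc d. int (card (A \<inter> B)) - a - int i))
     = (\<Sum>B\<in>F. c B * ?q B * (of_bool (I \<subseteq> B) * int (card (A \<inter> B))))
       - (a + int (Suc d)) * (\<Sum>B\<in>F. c B * of_bool (I \<subseteq> B) * ?q B)"
    by (simp add: sum_distrib_left sum_subtractf[symmetric] algebra_simps)
  also have "(\<Sum>B\<in>F. c B * ?q B * (of_bool (I \<subseteq> B) * int (card (A \<inter> B))))
     = (\<Sum>j\<in>A. \<Sum>B\<in>F. c B * of_bool (insert j I \<subseteq> B) * ?q B)"
    unfolding sum_of_bool_insert_subset[OF \<open>finite A\<close>, symmetric] sum_distrib_left
    by (subst sum.swap) (simp add: mult_ac)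
  also have "\<dots> = 0"
  proof (rule sum.neutral, rule ballI)
    fix j assume "j \<in> A"
    moreover have "card (insert j I) \<le> Suc (card I)" using Suc.prems by (simp add: card_insert_if)
    ultimately show "(\<Sum>B\<in>F. c B * of_bool (insert j I \<subseteq> B) * ?q B) = 0"
      using Suc.prems \<open>A \<subseteq> U\<close> by (intro Suc.IH) auto
  qed
  finally show ?case using Suc.IH[of I] Suc.prems by simp
qed

section \<open>The Frankl-Wilson theorem\<close>

text \<open>The \<open>i\<close> run through the nonzero residues. Together with the next lemma, the
  product thus detects modulo \<open>p\<close> whether \<open>x\<close> is divisible by
  \<open>p\<close>.\<close>

lemma prime_not_dvd_prod_consecutive:
  assumes "prime p" "int p dvd x"
  shows "\<not> int p dvd (\<Prod>i=1..p - 1. x - int i)"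
proof
  assume "int p dvd (\<Prod>i=1..p - 1. x - int i)"
  then obtain i where i: "i \<in> {1..p - 1}" "int p dvd x - int i"
    using assms(1) by (subst (asm) prime_dvd_prod_iff) auto
  then have "p dvd i"
    using assms(2) dvd_diff_right_iff[of "int p" x "int i"] by (simp add: dvd_diff_commute)
  then show False using i by (auto dest: dvd_imp_le)
qed

lemma prime_dvd_prod_consecutive:
  assumes "prime p" "\<not> int p dvd x"
  shows "int p dvd (\<Prod>i=1..p - 1. x - int i)"
proof -
  define i where "i = nat (x mod int p)"
  have "int p > 0" using assms by (simp add: prime_gt_0_nat)
  then have i: "int i = x mod int p" "int i < int p" by (auto simp: i_def)
  moreover have "i \<noteq> 0" using i assms by (auto simp: dvd_eq_mod_eq_0)
  ultimately have "i \<in> {1..p - 1}" by auto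
  moreover have "int p dvd x - int i" unfolding i by simp
  ultimately show ?thesis by (meson dvd_prod_eqI dvd_trans dvd_prodI finite_atLeastAtMost)
qed

text \<open>Infinite descent: if \<open>F\<close> were too large, nonzero integer weights on
  \<open>F\<close> would have vanishing moments of degree below \<open>p\<close>. Testing them
  against a polynomial that isolates \<open>A\<close> modulo \<open>p\<close> shows that
  \<open>p\<close> divides every weight, and the quotients are again such weights.\<close>

theorem frankl_wilson_uniform:
  assumes "finite U" and F: "\<And>B. B \<in> F \<Longrightarrow> B \<subseteq> U \<and> card B = k" and "prime p" "p \<le> k"
    and mod: "\<And>A B. A \<in> F \<Longrightarrow> B \<in> F \<Longrightarrow> A \<noteq> B \<Longrightarrow> card (A \<inter> B) mod p \<noteq> k mod p"
  shows "card F \<le> card U choose (p - 1)"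
proof (rule ccontr)
  assume large: "\<not> card F \<le> card U choose (p - 1)"
  \<comment> \<open>Only sets of size exactly \<open>p - 1\<close> give equations, hence a single
    binomial coefficient in the bound; the smaller moments vanish as a consequence.\<close>
  let ?E = "{J. J \<subseteq> U \<and> card J = p - 1}"
  define solves where
    "solves c \<longleftrightarrow> (\<forall>J\<in>?E. (\<Sum>B\<in>F. c B * of_bool (J \<subseteq> B)) = (0::int))" for c
  have "F \<subseteq> Pow U" using F by auto
  then have "finite F" using \<open>finite U\<close> finite_subset by blast
  have "card ?E < card F" "finite ?E"
    using large \<open>finite U\<close> by (auto simp: n_subsets)
  then obtain c where c: "\<exists>B\<in>F. c B \<noteq> 0" "solves c"
    unfolding solves_def
    using homogeneous_int_system_nontrivial[of ?E F "\<lambda>J B. of_bool (J \<subseteq> B)"] \<open>finite F\<close> by blast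
  have dvd: "int p dvd c A" if "solves c" "A \<in> F" for c A
  proof -
    \<comment> \<open>The shift by \<open>k\<close> makes the argument zero at \<open>B = A\<close>,
      so \<open>?q A\<close> is a unit modulo \<open>p\<close>, while \<open>mod\<close> makes
      \<open>p\<close> divide \<open>?q B\<close> for every other \<open>B\<close>.\<close>
    let ?q = "\<lambda>B. \<Prod>i=1..p - 1. int (card (A \<inter> B)) - int k - int i"
    have A: "A \<subseteq> U" "finite A" "card A = k"
      using F[OF \<open>A \<in> F\<close>] finite_subset[OF _ \<open>finite U\<close>] by auto
    have "(\<Sum>B\<in>F. c B * of_bool (I \<subseteq> B)) = 0"
      if "finite I" "I \<subseteq> U" "card I \<le> p - 1" for I
    proof (rule lower_degree_moments_vanish[OF \<open>finite U\<close> F])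
      show "p - 1 \<le> k" using \<open>p \<le> k\<close> by simp
    qed (use that \<open>solves c\<close> in \<open>auto simp: solves_def\<close>)
    from intersection_polynomial_moments_vanish[OF A(2) this A(1) finite.emptyI, where d = "p - 1" and a = "int k"]
    have "0 = (\<Sum>B\<in>F. c B * ?q B)" by simp
    also have "\<dots> = c A * ?q A + (\<Sum>B\<in>F - {A}. c B * ?q B)"
      using \<open>finite F\<close> \<open>A \<in> F\<close> by (simp add: sum.remove)
    finally have "c A * ?q A = - (\<Sum>B\<in>F - {A}. c B * ?q B)" by simp
    moreover have "int p dvd (\<Sum>B\<in>F - {A}. c B * ?q B)"
    proof (intro dvd_sum dvd_mult prime_dvd_prod_consecutive \<open>prime p\<close>)
      fix B assume "B \<in> F - {A}"
      with mod[of A B] \<open>A \<in> F\<close> show "\<not> int p dvd int (card (A \<inter> B)) - int k"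
        by (metis DiffD1 DiffD2 insertI1 mod_eq_dvd_iff of_nat_eq_iff zmod_int)
    qed
    ultimately have "int p dvd c A * ?q A" by simp
    moreover have "\<not> int p dvd ?q A"
      using \<open>prime p\<close> A by (intro prime_not_dvd_prod_consecutive) auto
    ultimately show ?thesis using \<open>prime p\<close> by (simp add: prime_dvd_mult_iff)
  qed
  have pow_dvd: "int p ^ e dvd c A" if "solves c" "A \<in> F" for e c A
    using that
  proof (induction e arbitrary: c)
    case (Suc e)
    define c' where "c' B = c B div int p" for B
    have c': "c B = int p * c' B" if "B \<in> F" for B
      using dvd[OF Suc.prems(1) that] by (simp add: c'_def)
    have scale: "int p * (\<Sum>B\<in>F. c' B * of_bool (J \<subseteq> B)) = (\<Sum>B\<in>F. c B * of_bool (J \<subseteq> B))" for J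
      unfolding sum_distrib_left by (intro sum.cong) (auto simp: c')
    have "int p \<noteq> 0" using \<open>prime p\<close> by (auto dest: prime_gt_0_nat)
    have "solves c'"
      unfolding solves_def
    proof
      fix J assume "J \<in> ?E"
      then have "int p * (\<Sum>B\<in>F. c' B * of_bool (J \<subseteq> B)) = 0"
        unfolding scale using Suc.prems(1) unfolding solves_def by blast
      then show "(\<Sum>B\<in>F. c' B * of_bool (J \<subseteq> B)) = 0"
        using \<open>int p \<noteq> 0\<close> mult_eq_0_iff by blast
    qed
    then show ?case using Suc.IH[of c'] c' Suc.prems by simp
  qed simp
  obtain A where A: "A \<in> F" "c A \<noteq> 0" using c by blast
  \<comment> \<open>A nonzero integer is not divisible by \<open>p\<close> to the power of its own
    absolute value.\<close>
  define e where "e = nat \<bar>c A\<bar>"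
  have "int p ^ e \<le> \<bar>c A\<bar>"
    using dvd_imp_le_int[OF A(2) pow_dvd[OF c(2) A(1), of e]] by simp
  moreover have "e < p ^ e"
    using \<open>prime p\<close> by (intro power_gt_expt) (auto dest: prime_gt_1_nat)
  then have "int e < int p ^ e" by (metis of_nat_less_iff of_nat_power)
  ultimately show False by (simp add: e_def)
qed

section \<open>Colour classes\<close>

lemma card_le_mult_colour_classes:
  assumes "finite S" "h ` S \<subseteq> {..<k}" and "\<And>i. i < k \<Longrightarrow> card {x \<in> S. h x = i} \<le> b"
  shows "card S \<le> k * b"
proof -
  have "card S = (\<Sum>i<k. card {x \<in> S. h x = i})"
    using sum.group[OF assms(1) finite_lessThan assms(2), of "\<lambda>_. 1::nat"] by simp
  also have "\<dots> \<le> (\<Sum>i<k. b)" using assms(3) by (intro sum_mono) auto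
  finally show ?thesis by simp
qed

lemma chromatic_number_colouring:
  assumes "compact S"
  obtains c where "unit_distance_colouring S (chromatic_number S) c"
  using LeastI_ex[OF compact_unit_distance_colouring[OF assms]] that
  unfolding chromatic_number_def by blast

section \<open>Sign vectors lifted to the sphere\<close>

text \<open>For \<open>j\<close> outside \<open>U\<close> the entry \<open>t\<close> is common to
  all \<open>A\<close>, so it adjusts the norm without affecting distances.\<close>

definition lifted_sign_vector ::
    "'n set \<Rightarrow> 'n \<Rightarrow> real \<Rightarrow> real \<Rightarrow> 'n set \<Rightarrow> real ^ 'n::finite" where
  "lifted_sign_vector U j s t A =
     (\<chi> i. if i \<in> A then s else if i \<in> U then - s else if i = j then t else 0)"

lemma norm_lifted_sign_vector:
  assumes "j \<notin> U" "A \<subseteq> U"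
  shows "(norm (lifted_sign_vector U j s t A))\<^sup>2 = real (card U) * s\<^sup>2 + t\<^sup>2"
proof -
  have "(norm (lifted_sign_vector U j s t A))\<^sup>2
      = (\<Sum>i\<in>UNIV. (lifted_sign_vector U j s t A $ i)\<^sup>2)"
    by (simp add: norm_vec_def L2_set_def sum_nonneg)
  also have "\<dots> = (\<Sum>i\<in>UNIV. (if i \<in> U then s\<^sup>2 else 0) + (if i = j then t\<^sup>2 else 0))"
    using assms by (intro sum.cong) (auto simp: lifted_sign_vector_def)
  finally show ?thesis by (simp add: sum.distrib sum.If_cases)
qed

lemma dist_lifted_sign_vector:
  assumes "A \<subseteq> U" "B \<subseteq> U"
  shows "(dist (lifted_sign_vector U j s t A) (lifted_sign_vector U j s t B))\<^sup>2
       = 4 * s\<^sup>2 * (real (card (A - B)) + real (card (B - A)))"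
proof -
  have "(dist (lifted_sign_vector U j s t A) (lifted_sign_vector U j s t B))\<^sup>2
      = (\<Sum>i\<in>UNIV. (lifted_sign_vector U j s t A $ i - lifted_sign_vector U j s t B $ i)\<^sup>2)"
    by (simp add: dist_norm norm_vec_def L2_set_def sum_nonneg)
  also have "\<dots> = (\<Sum>i\<in>UNIV. (if i \<in> A - B then 4 * s\<^sup>2 else 0) + (if i \<in> B - A then 4 * s\<^sup>2 else 0))"
    using assms by (intro sum.cong) (auto simp: lifted_sign_vector_def power2_eq_square)
  also have "\<dots> = real (card (A - B)) * (4 * s\<^sup>2) + real (card (B - A)) * (4 * s\<^sup>2)"
    by (simp only: sum.distrib sum.If_cases finite) (simp add: set_diff_eq)
  finally show ?thesis by (simp add: algebra_simps)
qed

section \<open>Arithmetic of m(n) and p(n)\<close>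

lemma max_mult4:
  assumes "n \<ge> 1"
  shows "max_mult4 (real n) < n" "4 dvd max_mult4 (real n)"
proof -
  have "max_mult4 (real n) \<in> {m. real m < real n \<and> 4 dvd m}"
    unfolding max_mult4_def
  proof (rule Max_in)
    show "finite {m. real m < real n \<and> 4 dvd m}"
      by (rule finite_subset[of _ "{..<n}"]) auto
    show "{m. real m < real n \<and> 4 dvd m} \<noteq> {}" using assms by (auto intro!: exI[of _ 0])
  qed
  then show "max_mult4 (real n) < n" "4 dvd max_mult4 (real n)" by auto
qed

lemma prime_gap_prime:
  assumes "real p = x + prime_gap x"
  shows "prime p" "real p > x"
proof -
  have "\<exists>q. prime q \<and> real q > x"
    using bigger_prime reals_Archimedean2[of x] by (meson less_trans of_nat_less_iff)
  then have "prime (LEAST q. prime q \<and> real q > x) \<and> real (LEAST q. prime q \<and> real q > x) > x"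
    by (rule LeastI_ex)
  then show "prime p" "real p > x" using assms by (simp_all add: prime_gap_def)
qed

text \<open>A multiple of \<open>p\<close> strictly between 0 and \<open>2 * p\<close> is
  \<open>p\<close> itself. This leaves a single forbidden intersection size.\<close>

lemma mod_neq_if_less:
  fixes x k p :: nat
  assumes "x < k" "k < 2 * p" "x \<noteq> k - p"
  shows "x mod p \<noteq> k mod p"
proof
  assume "x mod p = k mod p"
  then have "p dvd k - x"
    using assms(1) mod_eq_dvd_iff_nat[of x k p] by simp
  then obtain q where q: "k - x = p * q" by (elim dvdE)
  then have "p * q < p * 2" using assms by linarith
  moreover have "q \<noteq> 0" using q assms by (intro notI) simp
  ultimately have "q = 1" by simp
  then show False using q assms by simp
qed

section \<open>The lower bound for spheres\<close>

lemma chromatic_number_sphere_lower_bound: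
  assumes "prime p" "m < CARD('n::finite)" "even m" "m < 4 * p" "2 * p \<le> m"
    and "\<rho> > 0" "real m / (8 * \<rho>\<^sup>2) < real p"
  shows "m choose (m div 2) \<le> chromatic_number (sphere (0 :: real ^ 'n) \<rho>) * (m choose (p - 1))"
proof -
  define k where "k = m div 2"
  have k: "m = 2 * k" "k < 2 * p" "p \<le> k" using assms by (auto simp: k_def)
  have p0: "p > 0" using \<open>prime p\<close> by (rule prime_gt_0_nat)
  obtain U :: "'n set" where U: "card U = m" "finite U"
    using obtain_subset_with_card_n[of m "UNIV :: 'n set"] assms(2) by auto
  then obtain j where j: "j \<notin> U" using assms(2) by (metis UNIV_eq_I less_irrefl)
  \<comment> \<open>Two sets with both differences of size \<open>p\<close> give squared distance
    \<open>8 * p * s^2\<close>, which has to be 1.\<close>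
  define s where "s = sqrt (1 / (8 * real p))"
  \<comment> \<open>The radicand is positive exactly because
    \<open>m / (8 * \<rho>^2) < p\<close>.\<close>
  define t where "t = sqrt (\<rho>\<^sup>2 - real m / (8 * real p))"
  let ?v = "lifted_sign_vector U j s t"
  have s: "s\<^sup>2 = 1 / (8 * real p)" by (simp add: s_def)
  have t: "t\<^sup>2 = \<rho>\<^sup>2 - real m / (8 * real p)"
    using assms(6,7) p0 by (simp add: t_def field_simps)
  let ?S = "{A. A \<subseteq> U \<and> card A = k}"
  have sphere: "?v A \<in> sphere 0 \<rho>" if "A \<in> ?S" for A
  proof -
    have "(norm (?v A))\<^sup>2 = \<rho>\<^sup>2"
      using that j U by (simp add: norm_lifted_sign_vector s t)
    then show ?thesis using assms(6) by simp
  qed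
  have dist: "dist (?v A) (?v B) = 1" if "A \<in> ?S" "B \<in> ?S" "card (A \<inter> B) = k - p" for A B
  proof -
    \<comment> \<open>By \<open>p \<le> k\<close> the subtraction \<open>k - p\<close> is not
      truncated.\<close>
    have "card (A - B) = p" "card (B - A) = p"
      using that k by (auto simp: card_Diff_subset_Int Int_commute)
    then have "(dist (?v A) (?v B))\<^sup>2 = 1"
      using that p0 by (simp add: dist_lifted_sign_vector s)
    then show ?thesis using power2_eq_imp_eq[of "dist (?v A) (?v B)" 1] by simp
  qed
  let ?\<chi> = "chromatic_number (sphere (0 :: real ^ 'n) \<rho>)"
  obtain c where c: "unit_distance_colouring (sphere (0 :: real ^ 'n) \<rho>) ?\<chi> c"
    using chromatic_number_colouring[of "sphere (0 :: real ^ 'n) \<rho>"] by auto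
  have "card ?S \<le> ?\<chi> * (m choose (p - 1))"
  proof (rule card_le_mult_colour_classes)
    show "finite ?S" using U by simp
    show "(\<lambda>A. c (?v A)) ` ?S \<subseteq> {..<?\<chi>}"
      using c sphere unfolding unit_distance_colouring_def by blast
  next
    fix i
    show "card {A \<in> ?S. c (?v A) = i} \<le> (m choose (p - 1))"
      unfolding U(1)[symmetric]
    proof (rule frankl_wilson_uniform[OF \<open>finite U\<close> _ \<open>prime p\<close> \<open>p \<le> k\<close>])
      fix A B assume AB: "A \<in> {A \<in> ?S. c (?v A) = i}" "B \<in> {A \<in> ?S. c (?v A) = i}" "A \<noteq> B"
      have "c (?v A) = c (?v B)" "?v A \<in> sphere 0 \<rho>" "?v B \<in> sphere 0 \<rho>"
        using sphere[of A] sphere[of B] AB by auto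
      then have "dist (?v A) (?v B) \<noteq> 1"
        using c unfolding unit_distance_colouring_def by blast
      then have "card (A \<inter> B) \<noteq> k - p" using dist[of A B] AB by auto
      moreover have "card (A \<inter> B) < k"
      proof -
        have "A \<noteq> A \<inter> B"
          using AB card_subset_eq[of B A] finite[of B] by auto
        then have "A \<inter> B \<subset> A" by blast
        then show ?thesis using AB psubset_card_mono[of A "A \<inter> B"] finite[of A] by auto
      qed
      ultimately show "card (A \<inter> B) mod p \<noteq> k mod p"
        using k(2,3) by (intro mod_neq_if_less) auto
    qed auto
  qed
  then show ?thesis using U by (simp add: n_subsets k_def)
qed

theorem theorem4:
  fixes r :: "nat \<Rightarrow> real" and p :: "nat \<Rightarrow> nat" and n :: nat
  assumes "\<forall>k\<ge>1. r k > 1 / 2"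
    and "\<forall>k\<ge>1. real (p k) =
           real (max_mult4 (real k)) / (8 * (r k)\<^sup>2)
           + prime_gap (real (max_mult4 (real k)) / (8 * (r k)\<^sup>2))"
    and "n = CARD('n::finite)"
    and "real (max_mult4 (real n)) / 4 < real (p n)"
    and "real (p n) \<le> real (max_mult4 (real n)) / 2"
  shows "real (chromatic_number (sphere (0 :: real ^ 'n) (r n)))
           \<ge> real (max_mult4 (real n) choose (max_mult4 (real n) div 2))
             / real (max_mult4 (real n) choose p n)"
proof -
  define m where "m = max_mult4 (real n)"
  let ?\<chi> = "chromatic_number (sphere (0 :: real ^ 'n) (r n))"
  have n: "n \<ge> 1" using assms(3) by (simp add: Suc_le_eq)
  have m: "m < n" "4 dvd m" using max_mult4[OF n] by (auto simp: m_def)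
  have r: "r n > 0" using assms(1) n by (meson less_trans half_gt_zero zero_less_one)
  have p: "prime (p n)" "real m / (8 * (r n)\<^sup>2) < real (p n)"
    using prime_gap_prime[OF assms(2)[rule_format, OF n]] by (auto simp: m_def)
  have pm: "m < 4 * p n" "2 * p n \<le> m" using assms(4,5) by (auto simp: m_def[symmetric])
  have "even m" using m(2) by (meson dvd_trans even_numeral)
  have "m choose (m div 2) \<le> ?\<chi> * (m choose (p n - 1))"
    using p m pm r \<open>even m\<close> assms(3) by (intro chromatic_number_sphere_lower_bound) auto
  \<comment> \<open>Binomial coefficients increase up to the middle, and \<open>p n\<close> is at
    most \<open>m / 2\<close>.\<close>
  also have "\<dots> \<le> ?\<chi> * (m choose p n)"
    using pm by (intro mult_left_mono binomial_mono) auto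
  finally have "real (m choose (m div 2)) \<le> real ?\<chi> * real (m choose p n)"
    by (metis of_nat_le_iff of_nat_mult)
  moreover have "m choose p n > 0" using pm by simp
  ultimately show ?thesis unfolding m_def[symmetric] by (simp add: divide_le_eq)
qed

end
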